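(* Let $m$ and $t\ge 9$ be positive integers satisfying $\binom{t-1}{3} + \binom{t-2}{2}-1\le m \le \binom{t}{3}$. Let $G$ be a $3$-graph with vertex set $[t]$ and $m$ edges. If all but two edges of $[t-1]^{(3)}$ are in $G$ and $G$ does not contain a clique of order $t-1$ minus one edge, then $G$ is dense.
   Context: For a finite set $V$, $V^{(3)}$ denotes the family of all $3$-element subsets of $V$; $[n]=\{1,\dots,n\}$. A $3$-graph $G$ consists of a finite vertex set $V(G)$ and an edge set $E(G)\subseteq V(G)^{(3)}$. $H$ is a subgraph of $G$ if $V(H)\subseteq V(G)$ and $E(H)\subseteq E(G)$. $[n]^{(3)}$ also denotes the complete $3$-graph on $[n]$. A clique of order $p$ is a complete $3$-graph on $p$ vertices. "$G$ contains a clique of order $p$ minus one edge" means that $G$ has a (not necessarily induced) subgraph isomorphic to the $3$-graph obtained from $[p]^{(3)}$ by deleting one edge. For a $3$-graph $G$ with vertex set $[n]$ and $\vec x=(x_1,\dots,x_n)\in\mathbb R^n$, let $\lambda(G,\vec x)=\sum_{e\in E(G)}\prod_{i\in e}x_i$. The Lagrangian of $G$ is $\lambda(G)=\max\{\lambda(G,\vec x): \sum_{i=1}^n x_i=1,\ x_i\ge 0 \text{ for all } i\}$ (and analogously for an arbitrary finite vertex set). A $3$-graph $G$ is dense if every proper subgraph $G'$ of $G$ satisfies $\lambda(G')<\lambda(G)$ (equivalently, no optimum weighting of $G$ has a zero coordinate). *)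

theory Defs
  imports "HOL-Analysis.Analysis" "HOL-Library.Ramsey"
begin

text \<open>The set of \<open>3\<close>-element subsets of \<open>V\<close> is \<^term>\<open>[V]\<^bsup>3\<^esup>\<close> from the library
  (\<^const>\<open>nsets\<close>).\<close>

datatype 'a hgraph = HGraph (verts: "'a set") (edges: "'a set set")

definition is_3graph :: "'a hgraph \<Rightarrow> bool" where
  "is_3graph G \<longleftrightarrow> finite (verts G) \<and> edges G \<subseteq> [verts G]\<^bsup>3\<^esup>"

definition subgraph :: "'a hgraph \<Rightarrow> 'a hgraph \<Rightarrow> bool" where
  "subgraph H G \<longleftrightarrow> is_3graph H \<and> verts H \<subseteq> verts G \<and> edges H \<subseteq> edges G"

definition isomorphic :: "'a hgraph \<Rightarrow> 'b hgraph \<Rightarrow> bool" where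
  "isomorphic G H \<longleftrightarrow>
     (\<exists>f. bij_betw f (verts G) (verts H) \<and> (\<lambda>e. f ` e) ` edges G = edges H)"

definition contains_copy :: "'a hgraph \<Rightarrow> 'b hgraph \<Rightarrow> bool" where
  "contains_copy G K \<longleftrightarrow> (\<exists>H. subgraph H G \<and> isomorphic H K)"

definition contains_clique_minus_edge :: "'a hgraph \<Rightarrow> nat \<Rightarrow> bool" where
  "contains_clique_minus_edge G p \<longleftrightarrow>
     (\<exists>e \<in> [{1..p}]\<^bsup>3\<^esup>. contains_copy G (HGraph {1..p} ([{1..p}]\<^bsup>3\<^esup> - {e})))"

definition lagrangian_poly :: "'a hgraph \<Rightarrow> ('a \<Rightarrow> real) \<Rightarrow> real" where
  "lagrangian_poly G x = (\<Sum>e\<in>edges G. \<Prod>i\<in>e. x i)"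

text \<open>Weight vectors are total functions; their values outside \<open>V\<close> are unconstrained and
  do not enter the Lagrangian polynomial of a \<open>3\<close>-graph on \<open>V\<close>.\<close>

definition weightings :: "'a set \<Rightarrow> ('a \<Rightarrow> real) set" where
  "weightings V = {x. (\<forall>i\<in>V. x i \<ge> 0) \<and> (\<Sum>i\<in>V. x i) = 1}"

text \<open>The supremum is a maximum for every \<open>3\<close>-graph with at least one vertex
  (lemma \<open>lagrangian_attained\<close> below). If there is no vertex, there is no weighting and the
  value is unspecified.\<close>

definition lagrangian :: "'a hgraph \<Rightarrow> real" where
  "lagrangian G = (SUP x\<in>weightings (verts G). lagrangian_poly G x)"

text \<open>The subgraph without vertices has no Lagrangian and is therefore not among the
  subgraphs considered.\<close>

definition dense_3graph :: "'a hgraph \<Rightarrow> bool" where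
  "dense_3graph G \<longleftrightarrow>
     (\<forall>H. subgraph H G \<and> H \<noteq> G \<and> verts H \<noteq> {} \<longrightarrow> lagrangian H < lagrangian G)"

lemma lagrangian_attained:
  assumes G: "is_3graph G" and ne: "verts G \<noteq> {}"
  shows "\<exists>x\<in>weightings (verts G). lagrangian_poly G x = lagrangian G \<and>
           (\<forall>y\<in>weightings (verts G). lagrangian_poly G y \<le> lagrangian_poly G x)"
proof -
  let ?V = "verts G"
  let ?B = "PiE UNIV (\<lambda>i. if i \<in> ?V then {0..1} else {0}) :: ('a \<Rightarrow> real) set"
  let ?S = "?B \<inter> {x. (\<Sum>i\<in>?V. x i) = 1}"
  have fin: "finite ?V" and E: "\<And>e. e \<in> edges G \<Longrightarrow> e \<subseteq> ?V"
    using G by (auto simp: is_3graph_def nsets_def)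
  have cont: "continuous_on A (\<lambda>x. x i)" for A :: "('a \<Rightarrow> real) set" and i
    by (rule continuous_on_subset[OF continuous_on_product_coordinates]) simp
  have "compactin (product_topology (\<lambda>i. euclidean) UNIV) ?B"
    by (subst compactin_PiE) (auto simp: compactin_euclidean_iff)
  then have "compact ?B"
    by (simp add: euclidean_product_topology flip: compactin_euclidean_iff)
  moreover have "closed {x :: 'a \<Rightarrow> real. (\<Sum>i\<in>?V. x i) = 1}"
    by (intro closed_Collect_eq continuous_on_sum cont continuous_on_const)
  ultimately have comp: "compact ?S" by (rule compact_Int_closed)
  obtain v where v: "v \<in> ?V" using ne by blast
  have "(\<lambda>i. if i = v then 1 else 0) \<in> ?S" using v fin by (auto simp: PiE_def Pi_def)
  then have "?S \<noteq> {}" by blast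
  moreover have "continuous_on ?S (lagrangian_poly G)"
    unfolding lagrangian_poly_def
    by (intro continuous_on_sum continuous_on_prod cont)
  ultimately obtain x where x: "x \<in> ?S"
    and max: "\<And>y. y \<in> ?S \<Longrightarrow> lagrangian_poly G y \<le> lagrangian_poly G x"
    using continuous_attains_sup[OF comp] by metis
  have xw: "x \<in> weightings ?V"
  proof -
    have "0 \<le> x i" if "i \<in> ?V" for i
    proof -
      have "x i \<in> (if i \<in> ?V then {0..1} else {0})" using x by blast
      then show ?thesis using that by simp
    qed
    then show ?thesis using x by (simp add: weightings_def)
  qed
  have le: "lagrangian_poly G y \<le> lagrangian_poly G x" if y: "y \<in> weightings ?V" for y
  proof -
    let ?y = "\<lambda>i. if i \<in> ?V then y i else 0"
    have nn: "\<And>i. i \<in> ?V \<Longrightarrow> 0 \<le> y i" and s: "sum y ?V = 1"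
      using y by (auto simp: weightings_def)
    have "y i \<le> 1" if "i \<in> ?V" for i
      using member_le_sum[of i ?V y] that nn fin s by auto
    then have "?y \<in> ?S" using nn s by (auto simp: PiE_def Pi_def)
    moreover have "lagrangian_poly G ?y = lagrangian_poly G y"
      unfolding lagrangian_poly_def using E by (intro sum.cong prod.cong refl) auto
    ultimately show ?thesis using max[of ?y] by simp
  qed
  have "lagrangian G = lagrangian_poly G x"
    unfolding lagrangian_def using xw le by (intro cSup_eq_maximum) auto
  then show ?thesis using xw le by auto
qed

end

theory Submission
  imports Defs
begin

text \<open>
  Put \<open>n = t - 1\<close>, and suppose that some optimum weighting \<open>x\<close> of \<open>G\<close> vanishes at a vertex \<open>v\<close>.
  Let \<open>a\<close> be a vertex of largest weight \<open>M\<close>. The contradiction comes from moving a little weight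
  from \<open>a\<close> to \<open>v\<close>: since \<open>x\<close> is optimum and \<open>M > 0\<close>, the partial derivative at \<open>v\<close> cannot exceed
  the one at \<open>a\<close> (\<open>lagrangian_deriv_le_of_optimum\<close>), but here it does. Write \<open>e\<^sub>2\<close> for the second
  elementary symmetric function of all the weights.

  The derivative at \<open>a\<close> sums only over pairs of vertices other than \<open>a\<close>, so it is at most
  \<open>e\<^sub>2 - M (1 - M)\<close>. The derivative at \<open>v\<close> loses only the missing pairs of the link of \<open>v\<close>, because
  the pairs through \<open>v\<close> have weight \<open>0\<close>. In total \<open>G\<close> misses at most \<open>n\<close> triples. At least two of them
  avoid \<open>v\<close>, for otherwise deleting \<open>v\<close> would leave a clique of order \<open>n\<close> minus one edge
  (\<open>contains_clique_minus_edge_if_few_missing\<close>). So the link misses at most \<open>n - 2\<close> pairs, and the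
  derivative at \<open>v\<close> is at least \<open>e\<^sub>2 - (n - 2) M\<^sup>2\<close>. This exceeds \<open>e\<^sub>2 - M (1 - M)\<close> as soon as
  \<open>(n - 1) M < 1\<close>.

  It remains to see that no weight reaches \<open>1 / (n - 1)\<close>; that is, \<open>x\<close> is nearly uniform.
  The uniform weighting of \<open>[t - 1]\<close>, on which only two triples are missing, gives
  \<open>\<lambda>(G) \<ge> ((n choose 3) - 2) / n\<^sup>3\<close>. On the other hand, by Euler's identity
  \<open>3 \<lambda>(G)\<close> is the average of the derivatives under the weights \<open>x\<close>, hence at most the derivative at
  \<open>a\<close>, hence at most \<open>e\<^sub>2 - M (1 - M)\<close>; and \<open>e\<^sub>2 \<le> (n - 1) / (2 n)\<close> since \<open>x\<close> is supported on \<open>n\<close> vertices.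
  So \<open>M (1 - M)\<close> is at most \<open>(n - 1) / n\<^sup>2 + 6 / n\<^sup>3\<close>, which for \<open>n \<ge> 8\<close> is smaller than the value
  \<open>(n - 2) / (n - 1)\<^sup>2\<close> of \<open>M (1 - M)\<close> at \<open>M = 1 / (n - 1)\<close> (\<open>max_weight_bound\<close>).
\<close>

section \<open>Partial derivatives of the Lagrangian polynomial\<close>

definition lagrangian_deriv :: "'a hgraph \<Rightarrow> ('a \<Rightarrow> real) \<Rightarrow> 'a \<Rightarrow> real" where
  "lagrangian_deriv G x i = (\<Sum>e\<in>{e\<in>edges G. i \<in> e}. \<Prod>j\<in>e - {i}. x j)"

definition link :: "'a hgraph \<Rightarrow> 'a \<Rightarrow> 'a set set" where
  "link G v = (\<lambda>e. e - {v}) ` {e\<in>edges G. v \<in> e}"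

lemma finite_edges: "is_3graph G \<Longrightarrow> finite (edges G)"
  unfolding is_3graph_def by (meson finite_imp_finite_nsets finite_subset)

lemma edge_subset_verts: "\<lbrakk>is_3graph G; e \<in> edges G\<rbrakk> \<Longrightarrow> e \<subseteq> verts G"
  and finite_edge: "\<lbrakk>is_3graph G; e \<in> edges G\<rbrakk> \<Longrightarrow> finite e"
  and card_edge: "\<lbrakk>is_3graph G; e \<in> edges G\<rbrakk> \<Longrightarrow> card e = 3"
  by (auto simp: is_3graph_def nsets_def)

lemma link_subset_nsets:
  assumes "is_3graph G"
  shows "link G v \<subseteq> [verts G - {v}]\<^bsup>2\<^esup>"
  using assms by (auto simp: link_def nsets_def is_3graph_def)

lemma lagrangian_deriv_eq_sum_link:
  "lagrangian_deriv G x v = (\<Sum>f\<in>link G v. \<Prod>i\<in>f. x i)"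
proof -
  have "inj_on (\<lambda>e. e - {v}) {e\<in>edges G. v \<in> e}"
    by (rule inj_onI) auto
  then show ?thesis
    by (simp add: lagrangian_deriv_def link_def sum.reindex)
qed

text \<open>Euler's identity for a form of degree \<open>3\<close>.\<close>

lemma sum_lagrangian_deriv:
  assumes G: "is_3graph G"
  shows "(\<Sum>i\<in>verts G. x i * lagrangian_deriv G x i) = 3 * lagrangian_poly G x"
proof -
  have fV: "finite (verts G)" using G by (simp add: is_3graph_def)
  have "(\<Sum>i\<in>verts G. x i * lagrangian_deriv G x i)
      = (\<Sum>i\<in>verts G. \<Sum>e\<in>{e\<in>edges G. i \<in> e}. \<Prod>j\<in>e. x j)"
    unfolding lagrangian_deriv_def sum_distrib_left
    by (intro sum.cong refl) (auto simp: prod.remove[OF finite_edge[OF G]])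
  also have "\<dots> = (\<Sum>e\<in>edges G. \<Sum>i\<in>{i\<in>verts G. i \<in> e}. \<Prod>j\<in>e. x j)"
    by (rule sum.swap_restrict) (use fV finite_edges[OF G] in auto)
  also have "\<dots> = (\<Sum>e\<in>edges G. 3 * (\<Prod>j\<in>e. x j))"
  proof (intro sum.cong refl)
    fix e assume e: "e \<in> edges G"
    have "{i\<in>verts G. i \<in> e} = e" using edge_subset_verts[OF G e] by auto
    then show "(\<Sum>i\<in>{i\<in>verts G. i \<in> e}. \<Prod>j\<in>e. x j) = 3 * (\<Prod>j\<in>e. x j)"
      using card_edge[OF G e] by simp
  qed
  finally show ?thesis by (simp add: lagrangian_poly_def sum_distrib_left)
qed

text \<open>Every vertex occurs at most once in an edge, so moving weight \<open>s\<close> from \<open>a\<close> to \<open>b\<close> changes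
  the polynomial by an expression that is exactly quadratic in \<open>s\<close>.\<close>

lemma lagrangian_poly_shift:
  assumes G: "is_3graph G" and ab: "a \<noteq> b"
  shows "lagrangian_poly G (x(a := x a - s, b := x b + s))
       = lagrangian_poly G x + s * (lagrangian_deriv G x b - lagrangian_deriv G x a)
         - s^2 * (\<Sum>e\<in>{e\<in>edges G. a \<in> e \<and> b \<in> e}. \<Prod>j\<in>e - {a, b}. x j)"
proof -
  let ?y = "x(a := x a - s, b := x b + s)"
  let ?d = "\<lambda>i e. if i \<in> e then \<Prod>j\<in>e - {i}. x j else 0"
  let ?c = "\<lambda>e. if a \<in> e \<and> b \<in> e then \<Prod>j\<in>e - {a, b}. x j else 0"
  have edge: "(\<Prod>j\<in>e. ?y j) = (\<Prod>j\<in>e. x j) + s * (?d b e - ?d a e) - s^2 * ?c e"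
    if "e \<in> edges G" for e
  proof -
    have fe: "finite e" using finite_edge[OF G that] .
    have y: "(\<Prod>j\<in>A. ?y j) = (\<Prod>j\<in>A. x j)" if "a \<notin> A" "b \<notin> A" for A
      using that by (intro prod.cong) auto
    consider "a \<in> e" "b \<in> e" | "a \<in> e" "b \<notin> e" | "a \<notin> e" "b \<in> e" | "a \<notin> e" "b \<notin> e"
      by blast
    then show ?thesis
    proof cases
      case 1
      define R where "R = (\<Prod>j\<in>e - {a, b}. x j)"
      have minus: "e - {a} - {b} = e - {a, b}" "e - {b} - {a} = e - {a, b}" by auto
      have split: "(\<Prod>j\<in>e. z j) = z a * z b * (\<Prod>j\<in>e - {a, b}. z j)" for z :: "'a \<Rightarrow> real"
        using 1 ab fe prod.remove[of e a z] prod.remove[of "e - {a}" b z] by (simp add: minus)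
      have "(\<Prod>j\<in>e - {a}. x j) = x b * R" "(\<Prod>j\<in>e - {b}. x j) = x a * R"
        using 1 ab fe prod.remove[of "e - {a}" b x] prod.remove[of "e - {b}" a x]
        by (simp_all add: R_def minus)
      moreover have "(\<Prod>j\<in>e - {a, b}. ?y j) = R" unfolding R_def by (rule y) auto
      ultimately show ?thesis
        using 1 ab split[of ?y] split[of x]
        by (simp add: R_def[symmetric] algebra_simps power2_eq_square)
    next
      case 2
      then show ?thesis
        using ab fe y[of "e - {a}"] prod.remove[of e a x] prod.remove[of e a ?y]
        by (simp add: algebra_simps)
    next
      case 3
      then show ?thesis
        using ab fe y[of "e - {b}"] prod.remove[of e b x] prod.remove[of e b ?y]
        by (simp add: algebra_simps)
    next
      case 4
      then show ?thesis using y[of e] by simp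
    qed
  qed
  have "lagrangian_poly G ?y
      = (\<Sum>e\<in>edges G. (\<Prod>j\<in>e. x j) + s * (?d b e - ?d a e) - s^2 * ?c e)"
    unfolding lagrangian_poly_def by (rule sum.cong[OF refl edge])
  also have "\<dots> = lagrangian_poly G x + s * (sum (?d b) (edges G) - sum (?d a) (edges G))
      - s^2 * sum ?c (edges G)"
    unfolding lagrangian_poly_def by (simp add: sum.distrib sum_subtractf flip: sum_distrib_left)
  finally show ?thesis
    unfolding lagrangian_deriv_def by (simp add: sum.inter_filter finite_edges[OF G])
qed

section \<open>First-order conditions at an optimum weighting\<close>

lemma lagrangian_deriv_le_of_optimum:
  assumes G: "is_3graph G" and x: "x \<in> weightings (verts G)"
    and opt: "\<And>y. y \<in> weightings (verts G) \<Longrightarrow> lagrangian_poly G y \<le> lagrangian_poly G x"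
    and a: "a \<in> verts G" "x a > 0" and b: "b \<in> verts G"
  shows "lagrangian_deriv G x b \<le> lagrangian_deriv G x a"
proof (rule ccontr)
  define d where "d = lagrangian_deriv G x b - lagrangian_deriv G x a"
  define c where "c = (\<Sum>e\<in>{e\<in>edges G. a \<in> e \<and> b \<in> e}. \<Prod>j\<in>e - {a, b}. x j)"
  assume "\<not> ?thesis"
  then have d: "d > 0" and ab: "a \<noteq> b" by (auto simp: d_def)
  (* small enough for the linear gain s * d to dominate the quadratic term s^2 * c *)
  define s where "s = min (x a) (d / (2 * (\<bar>c\<bar> + 1)))"
  have s: "s > 0" "s \<le> x a" using a d by (auto simp: s_def)
  have "s * (\<bar>c\<bar> + 1) \<le> d / (2 * (\<bar>c\<bar> + 1)) * (\<bar>c\<bar> + 1)"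
    by (intro mult_right_mono) (auto simp: s_def)
  also have "\<dots> = d / 2" by (simp add: field_simps)
  finally have "s * (\<bar>c\<bar> + 1) \<le> d / 2" .
  moreover have "s * c \<le> s * (\<bar>c\<bar> + 1)" using s by (intro mult_left_mono) auto
  ultimately have "s * c < d" using d by linarith
  then have gain: "s * d - s^2 * c > 0"
    using s mult_strict_left_mono[of "s * c" d s] by (simp add: power2_eq_square algebra_simps)
  let ?y = "x(a := x a - s, b := x b + s)"
  have fV: "finite (verts G)" using G by (simp add: is_3graph_def)
  have "(\<Sum>i\<in>verts G. ?y i) = (\<Sum>i\<in>verts G. x i + (if i = b then s else 0) - (if i = a then s else 0))"
    using ab by (intro sum.cong) auto
  also have "\<dots> = (\<Sum>i\<in>verts G. x i)"
    using fV a b by (simp add: sum.distrib sum_subtractf)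
  finally have "?y \<in> weightings (verts G)"
    using x s by (auto simp: weightings_def)
  then have "lagrangian_poly G ?y \<le> lagrangian_poly G x" by (rule opt)
  then show False
    using gain unfolding lagrangian_poly_shift[OF G ab] d_def c_def by linarith
qed

lemma lagrangian_poly_le_deriv_of_optimum:
  assumes G: "is_3graph G" and x: "x \<in> weightings (verts G)"
    and opt: "\<And>y. y \<in> weightings (verts G) \<Longrightarrow> lagrangian_poly G y \<le> lagrangian_poly G x"
    and a: "a \<in> verts G" "x a > 0"
  shows "3 * lagrangian_poly G x \<le> lagrangian_deriv G x a"
proof -
  have "3 * lagrangian_poly G x = (\<Sum>i\<in>verts G. x i * lagrangian_deriv G x i)"
    using sum_lagrangian_deriv[OF G] by simp
  also have "\<dots> \<le> (\<Sum>i\<in>verts G. x i * lagrangian_deriv G x a)"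
    using x by (intro sum_mono mult_left_mono lagrangian_deriv_le_of_optimum[OF G x opt a])
      (auto simp: weightings_def)
  also have "\<dots> = lagrangian_deriv G x a"
    using x by (simp add: weightings_def flip: sum_distrib_right)
  finally show ?thesis .
qed

section \<open>Sums over pairs\<close>

definition pair_sum :: "'a set \<Rightarrow> ('a \<Rightarrow> real) \<Rightarrow> real" where
  "pair_sum A x = (\<Sum>f\<in>[A]\<^bsup>2\<^esup>. \<Prod>i\<in>f. x i)"

lemma pair_sum_insert:
  assumes A: "finite A" "a \<notin> A"
  shows "pair_sum (insert a A) x = pair_sum A x + x a * (\<Sum>i\<in>A. x i)"
proof -
  have split: "[insert a A]\<^bsup>2\<^esup> = [A]\<^bsup>2\<^esup> \<union> (\<lambda>b. {a, b}) ` A"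
    using A by (auto simp: nsets_2_eq)
  have "inj_on (\<lambda>b. {a, b}) A" by (auto simp: inj_on_def doubleton_eq_iff)
  moreover have "(\<Prod>i\<in>{a, b}. x i) = x a * x b" if "b \<in> A" for b
    using that A by (subst prod.insert) auto
  ultimately have "(\<Sum>f\<in>(\<lambda>b. {a, b}) ` A. \<Prod>i\<in>f. x i) = x a * (\<Sum>i\<in>A. x i)"
    by (simp add: sum.reindex sum_distrib_left)
  moreover have "[A]\<^bsup>2\<^esup> \<inter> (\<lambda>b. {a, b}) ` A = {}"
    using A by (auto simp: nsets_def)
  ultimately show ?thesis
    unfolding pair_sum_def split using A
    by (subst sum.union_disjoint) (auto simp: finite_imp_finite_nsets)
qed

lemma pair_sum_eq_power_sums:
  assumes "finite A"
  shows "2 * pair_sum A x = (\<Sum>i\<in>A. x i)^2 - (\<Sum>i\<in>A. (x i)^2)"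
  using assms
proof induction
  case empty
  show ?case by (simp add: pair_sum_def nsets_2_eq)
next
  case (insert a A)
  then show ?case by (simp add: pair_sum_insert power2_eq_square algebra_simps)
qed

lemma lagrangian_deriv_le_pair_sum:
  assumes G: "is_3graph G" and nonneg: "\<And>i. i \<in> verts G \<Longrightarrow> x i \<ge> 0"
  shows "lagrangian_deriv G x v \<le> pair_sum (verts G - {v}) x"
  unfolding lagrangian_deriv_eq_sum_link pair_sum_def
proof (rule sum_mono2[OF _ link_subset_nsets[OF G]])
  show "finite ([verts G - {v}]\<^bsup>2\<^esup>)"
    using G by (simp add: is_3graph_def finite_imp_finite_nsets)
  show "0 \<le> (\<Prod>i\<in>f. x i)" if "f \<in> [verts G - {v}]\<^bsup>2\<^esup> - link G v" for f
    using that nonneg by (intro prod_nonneg) (auto simp: nsets_def)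
qed

lemma pair_sum_le_lagrangian_deriv:
  fixes M :: real
  assumes G: "is_3graph G" and x: "\<And>i. i \<in> verts G \<Longrightarrow> 0 \<le> x i \<and> x i \<le> M"
  shows "pair_sum (verts G - {v}) x
      \<le> lagrangian_deriv G x v + card ([verts G - {v}]\<^bsup>2\<^esup> - link G v) * M^2"
proof -
  let ?N = "[verts G - {v}]\<^bsup>2\<^esup>"
  have fin: "finite ?N" using G by (simp add: is_3graph_def finite_imp_finite_nsets)
  have "(\<Prod>i\<in>f. x i) \<le> M^2" if "f \<in> ?N - link G v" for f
  proof -
    have f: "f \<subseteq> verts G" "card f = 2" using that by (auto simp: nsets_def)
    have "(\<Prod>i\<in>f. x i) \<le> (\<Prod>i\<in>f. M)" using f x by (intro prod_mono) auto
    then show ?thesis using f by simp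
  qed
  then have "(\<Sum>f\<in>?N - link G v. \<Prod>i\<in>f. x i) \<le> (\<Sum>f\<in>?N - link G v. M^2)"
    by (rule sum_mono)
  moreover have "pair_sum (verts G - {v}) x
      = (\<Sum>f\<in>?N - link G v. \<Prod>i\<in>f. x i) + lagrangian_deriv G x v"
    unfolding pair_sum_def lagrangian_deriv_eq_sum_link
    by (rule sum.subset_diff[OF link_subset_nsets[OF G] fin])
  ultimately show ?thesis by simp
qed

section \<open>Optimum weightings are nearly uniform and positive\<close>

lemma real_choose_3: "real (n choose 3) = real n * (real n - 1) * (real n - 2) / 6"
  by (simp add: binomial_gbinomial gbinomial_prod_rev eval_nat_numeral)

text \<open>Here \<open>M\<close> is the largest weight and \<open>s\<close> the sum of the squared weights; the last hypothesis
  compares the uniform lower bound for \<open>3 \<lambda>(G)\<close> with the upper bound \<open>e\<^sub>2 - M (1 - M)\<close>. Below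
  \<open>1 - 1 / (k - 1)\<close> concavity of \<open>M (1 - M)\<close> reduces the claim to the end point \<open>M = 1 / (k - 1)\<close>,
  where it amounts to \<open>k\<^sup>3 - 9 k\<^sup>2 + 13 k - 6 > 0\<close>. Beyond that point nearly all the weight is on one
  vertex, and \<open>e\<^sub>2\<close> itself is too small.\<close>

lemma max_weight_bound:
  fixes k M s :: real
  assumes k: "k \<ge> 8" and M: "0 \<le> M" "M \<le> 1" and s: "M^2 \<le> s" "1 / k \<le> s"
    and le: "(k - 1) * (k - 2) / (2 * k^2) - 6 / k^3 \<le> (1 - s) / 2 - M * (1 - M)"
  shows "(k - 1) * M < 1"
proof (rule ccontr)
  define r where "r = 1 / (k - 1)"
  have r: "r > 0" "(k - 1) * r = 1" using k by (auto simp: r_def)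
  assume "\<not> ?thesis"
  then have Mr: "r \<le> M" using k by (simp add: r_def field_simps)
  have clear: "k^3 * ((k - 1) * (k - 2) / (2 * k^2) - 6 / k^3) = k * (k - 1) * (k - 2) / 2 - 6"
    using k by (simp add: field_simps power2_eq_square power3_eq_cube)
  show False
  proof (cases "M \<le> 1 - r")
    case True
    have "0 \<le> (M - r) * (1 - r - M)" using Mr True by (intro mult_nonneg_nonneg) auto
    then have "r * (1 - r) \<le> M * (1 - M)" by (simp add: algebra_simps)
    then have "(k - 1) * (k - 2) / (2 * k^2) - 6 / k^3 \<le> (1 - 1 / k) / 2 - r * (1 - r)"
      using s(2) by (intro order_trans[OF le] diff_mono) auto
    then have "k^3 * ((k - 1) * (k - 2) / (2 * k^2) - 6 / k^3)
        \<le> k^3 * ((1 - 1 / k) / 2 - r * (1 - r))"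
      using k by (intro mult_left_mono) auto
    also have "\<dots> = k^2 * (k - 1) / 2 - k^3 * (r * (1 - r))"
      using k by (simp add: field_simps power2_eq_square power3_eq_cube)
    finally have "k^3 * (r * (1 - r)) \<le> k^2 * (k - 1) / 2 - (k * (k - 1) * (k - 2) / 2 - 6)"
      unfolding clear by linarith
    also have "\<dots> = k * (k - 1) + 6" by (simp add: field_simps power2_eq_square)
    finally have "k^3 * (r * (1 - r)) \<le> k * (k - 1) + 6" .
    then have "(k - 1)^2 * (k^3 * (r * (1 - r))) \<le> (k - 1)^2 * (k * (k - 1) + 6)"
      by (intro mult_left_mono) auto
    moreover have "(k - 1)^2 * (k^3 * (r * (1 - r))) = k^3 * (((k - 1) * r) * ((k - 1) - (k - 1) * r))"
      by (simp add: power2_eq_square algebra_simps)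
    ultimately have "k^3 * (k - 2) \<le> (k - 1)^2 * (k * (k - 1) + 6)"
      unfolding r by simp
    then have "k * k * (k - 9) + 13 * k - 6 \<le> 0"
      by (simp add: power2_eq_square power3_eq_cube algebra_simps)
    (* expanded around k = 8, the cubic has only positive coefficients *)
    moreover have "k * k * (k - 9) + 13 * k - 6
        = (k - 8)^3 + 15 * (k - 8)^2 + 61 * (k - 8) + 34"
      by (simp add: power2_eq_square power3_eq_cube algebra_simps)
    moreover have "0 < (k - 8)^3 + 15 * (k - 8)^2 + 61 * (k - 8) + 34"
      using k by (intro add_nonneg_pos add_nonneg_nonneg) auto
    ultimately show False by simp
  next
    case False
    have "(1 - s) / 2 - M * (1 - M) \<le> (1 - M)^2 / 2"
      using s(1) by (simp add: power2_eq_square field_simps)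
    also have "\<dots> \<le> r^2 / 2" using False M by (intro divide_right_mono power_mono) auto
    finally have "(k - 1) * (k - 2) / (2 * k^2) - 6 / k^3 \<le> r^2 / 2" using le by linarith
    then have "k^3 * ((k - 1) * (k - 2) / (2 * k^2) - 6 / k^3) \<le> k^3 * (r^2 / 2)"
      using k by (intro mult_left_mono) auto
    also have "\<dots> = k * (k * r)^2 / 2" by (simp add: power2_eq_square power3_eq_cube)
    also have "\<dots> \<le> k * 2^2 / 2"
      using k r by (intro divide_right_mono mult_left_mono power_mono) (auto simp: r_def field_simps)
    finally have *: "k * (k - 1) * (k - 2) \<le> 4 * k + 12" unfolding clear by simp
    have "k * (7 * 6) \<le> k * ((k - 1) * (k - 2))"
      using k by (intro mult_left_mono mult_mono) auto
    also have "\<dots> \<le> 4 * k + 12" using * by (simp only: mult.assoc)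
    finally show False using k by simp
  qed
qed

text \<open>If \<open>x v = 0\<close>, then the missing pairs of the link cost the derivative at \<open>v\<close> at most
  \<open>(n - 2) M\<^sup>2\<close>, whereas the derivative at a vertex of weight \<open>M\<close> lacks all the pairs through that
  vertex, which weigh \<open>M (1 - M)\<close>. The lower bound for the Lagrangian keeps \<open>M\<close> small enough for the
  second loss to be the larger one.\<close>

lemma optimum_weighting_pos:
  fixes G :: "'a hgraph"
  assumes G: "is_3graph G" and card: "card (verts G) = n + 1" and n: "n \<ge> 8"
    and x: "x \<in> weightings (verts G)"
    and opt: "\<And>y. y \<in> weightings (verts G) \<Longrightarrow> lagrangian_poly G y \<le> lagrangian_poly G x"
    and lower: "(real (n choose 3) - 2) / real n^3 \<le> lagrangian_poly G x"
    and v: "v \<in> verts G" and few: "card ([verts G - {v}]\<^bsup>2\<^esup> - link G v) + 2 \<le> n"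
  shows "x v > 0"
proof (rule ccontr)
  let ?V = "verts G"
  assume "\<not> ?thesis"
  then have xv: "x v = 0" using x v by (force simp: weightings_def)
  have fV: "finite ?V" using G by (simp add: is_3graph_def)
  have nonneg: "\<And>i. i \<in> ?V \<Longrightarrow> x i \<ge> 0" and sum1: "(\<Sum>i\<in>?V. x i) = 1"
    using x by (auto simp: weightings_def)
  define M where "M = Max (x ` ?V)"
  have "M \<in> x ` ?V" unfolding M_def using fV v by (intro Max_in) auto
  then obtain a where a: "a \<in> ?V" "x a = M" by auto
  have le_M: "x i \<le> M" if "i \<in> ?V" for i unfolding M_def using fV that by simp
  have "M \<noteq> 0"
  proof
    assume "M = 0"
    then have "\<forall>i\<in>?V. x i = 0" using le_M nonneg by (metis order_antisym)
    then show False using sum1 by simp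
  qed
  then have "M > 0" using nonneg[OF a(1)] a by simp
  moreover have "x a \<le> (\<Sum>i\<in>?V. x i)"
    using a(1) fV nonneg by (intro member_le_sum) auto
  ultimately have M: "M > 0" "M \<le> 1" using a sum1 by auto
  define s where "s = (\<Sum>i\<in>?V. (x i)^2)"
  have remove: "pair_sum ?V x = pair_sum (?V - {u}) x + x u * (1 - x u)" if "u \<in> ?V" for u
  proof -
    have "pair_sum ?V x = pair_sum (insert u (?V - {u})) x"
      using that by (simp add: insert_absorb)
    also have "\<dots> = pair_sum (?V - {u}) x + x u * (\<Sum>i\<in>?V - {u}. x i)"
      using fV by (subst pair_sum_insert) auto
    also have "(\<Sum>i\<in>?V - {u}. x i) = 1 - x u"
      using sum1 sum.remove[OF fV that, of x] by simp
    finally show ?thesis .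
  qed
  have deriv_a: "lagrangian_deriv G x a \<le> pair_sum ?V x - M * (1 - M)"
    using lagrangian_deriv_le_pair_sum[OF G, of x a] nonneg remove[OF a(1)] a(2) by simp
  have "(n - 1) * M < 1"
  proof -
    let ?k = "real n"
    have "M^2 \<le> s"
      unfolding s_def a(2)[symmetric] using a(1) fV by (intro member_le_sum) auto
    moreover have "1 / ?k \<le> s"
    proof -
      (* Cauchy-Schwarz on the n vertices other than v, which carry all the weight *)
      have "1 = (\<Sum>i\<in>?V - {v}. x i)^2"
        using sum1 sum.remove[OF fV v, of x] xv by simp
      also have "\<dots> \<le> (\<Sum>i\<in>?V - {v}. (x i)^2) * card (?V - {v})"
        by (rule sum_squared_le_sum_of_squares)
      also have "\<dots> = s * ?k"
        using card fV v xv sum.remove[OF fV v, of "\<lambda>i. (x i)^2"] by (simp add: s_def)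
      finally show ?thesis using n by (simp add: field_simps)
    qed
    moreover have "(?k - 1) * (?k - 2) / (2 * ?k^2) - 6 / ?k^3 \<le> (1 - s) / 2 - M * (1 - M)"
    proof -
      have "(?k - 1) * (?k - 2) / (2 * ?k^2) - 6 / ?k^3 = 3 * ((real (n choose 3) - 2) / ?k^3)"
        using n by (simp add: real_choose_3 field_simps power2_eq_square power3_eq_cube)
      also have "\<dots> \<le> 3 * lagrangian_poly G x" using lower by (rule mult_left_mono) simp
      also have "\<dots> \<le> lagrangian_deriv G x a"
        using M a by (intro lagrangian_poly_le_deriv_of_optimum[OF G x opt]) auto
      also have "\<dots> \<le> pair_sum ?V x - M * (1 - M)" by (rule deriv_a)
      also have "pair_sum ?V x = (1 - s) / 2"
        using pair_sum_eq_power_sums[OF fV, of x] sum1 by (simp add: s_def)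
      finally show ?thesis .
    qed
    ultimately have "(?k - 1) * M < 1" using n M by (intro max_weight_bound[of ?k M s]) auto
    then show ?thesis using n by (simp add: of_nat_diff)
  qed
  then have "(real n - 2) * M^2 < M * (1 - M)"
    using M n mult_strict_left_mono[of "(real n - 1) * M" 1 M]
    by (simp add: of_nat_diff power2_eq_square algebra_simps)
  moreover have "card ([?V - {v}]\<^bsup>2\<^esup> - link G v) * M^2 \<le> (real n - 2) * M^2"
    using few by (intro mult_right_mono) auto
  moreover have "pair_sum ?V x
      \<le> lagrangian_deriv G x v + card ([?V - {v}]\<^bsup>2\<^esup> - link G v) * M^2"
    using pair_sum_le_lagrangian_deriv[OF G, of x M v] nonneg le_M remove[OF v] xv by simp
  ultimately have "lagrangian_deriv G x a < lagrangian_deriv G x v"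
    using deriv_a by linarith
  moreover have "lagrangian_deriv G x v \<le> lagrangian_deriv G x a"
    using M a by (intro lagrangian_deriv_le_of_optimum[OF G x opt _ _ v]) auto
  ultimately show False by simp
qed

section \<open>Density and positivity of optimum weightings\<close>

text \<open>An optimum weighting of a proper subgraph \<open>H\<close> with the same Lagrangian, extended by \<open>0\<close>, is
  optimum for \<open>G\<close>. If it is positive, then \<open>H\<close> has all the vertices, and each edge missing from
  \<open>H\<close> contributes a positive amount to \<open>G\<close> but not to \<open>H\<close>.\<close>

lemma dense_3graph_if_optimum_pos:
  assumes G: "is_3graph G"
    and pos: "\<And>x v. \<lbrakk>x \<in> weightings (verts G);
        \<And>y. y \<in> weightings (verts G) \<Longrightarrow> lagrangian_poly G y \<le> lagrangian_poly G x;
        v \<in> verts G\<rbrakk> \<Longrightarrow> x v > 0"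
  shows "dense_3graph G"
  unfolding dense_3graph_def
proof (intro allI impI, elim conjE, rule ccontr)
  fix H assume sub: "subgraph H G" and ne: "H \<noteq> G" "verts H \<noteq> {}"
    and "\<not> lagrangian H < lagrangian G"
  then have ge: "lagrangian G \<le> lagrangian H" by simp
  have H: "is_3graph H" "verts H \<subseteq> verts G" "edges H \<subseteq> edges G"
    using sub by (auto simp: subgraph_def)
  have fV: "finite (verts G)" using G by (simp add: is_3graph_def)
  obtain x where x: "x \<in> weightings (verts H)" "lagrangian_poly H x = lagrangian H"
    using lagrangian_attained[OF H(1) ne(2)] by blast
  define y where "y i = (if i \<in> verts H then x i else 0)" for i
  have "(\<Sum>i\<in>verts G. y i) = (\<Sum>i\<in>verts H. x i)"
    unfolding y_def using fV H(2) by (simp add: sum.If_cases Int_absorb1)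
  then have y: "y \<in> weightings (verts G)" using x by (auto simp: weightings_def y_def)
  have "lagrangian_poly H y = lagrangian_poly H x"
    unfolding lagrangian_poly_def y_def using edge_subset_verts[OF H(1)]
    by (intro sum.cong prod.cong refl) auto
  then have polyH: "lagrangian_poly H y = lagrangian H" using x by simp
  have max: "lagrangian_poly G z \<le> lagrangian G" if "z \<in> weightings (verts G)" for z
    using lagrangian_attained[OF G] that ne(2) H(2) by fastforce
  have nonneg: "(\<Prod>i\<in>e. y i) \<ge> 0" if "e \<in> edges G" for e
    using y edge_subset_verts[OF G that] by (intro prod_nonneg) (auto simp: weightings_def)
  have split: "lagrangian_poly G y = (\<Sum>e\<in>edges G - edges H. \<Prod>i\<in>e. y i) + lagrangian_poly H y"
    unfolding lagrangian_poly_def by (rule sum.subset_diff[OF H(3) finite_edges[OF G]])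
  have "(\<Sum>e\<in>edges G - edges H. \<Prod>i\<in>e. y i) \<ge> 0" using nonneg by (intro sum_nonneg) auto
  with split polyH ge max[OF y]
  have poly: "lagrangian_poly G y = lagrangian G" "(\<Sum>e\<in>edges G - edges H. \<Prod>i\<in>e. y i) = 0"
    by auto
  have ypos: "y v > 0" if "v \<in> verts G" for v
    using pos[OF y _ that] max poly by auto
  then have verts: "verts H = verts G" using H(2) by (force simp: y_def split: if_splits)
  then have "edges H \<noteq> edges G" using ne(1) by (metis hgraph.expand)
  then obtain e where e: "e \<in> edges G" "e \<notin> edges H" using H(3) by blast
  then have "(\<Prod>i\<in>e. y i) = 0"
    using poly(2) nonneg finite_edges[OF G] by (subst (asm) sum_nonneg_eq_0_iff) auto
  moreover have "(\<Prod>i\<in>e. y i) > 0"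
    using ypos edge_subset_verts[OF G e(1)] by (intro prod_pos) auto
  ultimately show False by simp
qed

section \<open>Missing triples\<close>

lemma card_nsets: "finite A \<Longrightarrow> card ([A]\<^bsup>k\<^esup>) = card A choose k"
  by (simp add: nsets_def n_subsets finite_subset conj_ac cong: conj_cong)

lemma contains_clique_minus_edge_if_few_missing:
  assumes W: "W \<subseteq> verts G" "finite W" "card W = p" "p \<ge> 3"
    and few: "card ([W]\<^bsup>3\<^esup> - edges G) \<le> 1"
  shows "contains_clique_minus_edge G p"
proof -
  have fin: "finite ([W]\<^bsup>3\<^esup>)" using W by (simp add: finite_imp_finite_nsets)
  have ne: "[W]\<^bsup>3\<^esup> \<noteq> {}" using W by (simp add: nsets_eq_empty_iff)
  (* if no triple is missing, an arbitrary one may be dropped *)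
  obtain e where e: "e \<in> [W]\<^bsup>3\<^esup>" "[W]\<^bsup>3\<^esup> - {e} \<subseteq> edges G"
  proof (cases "[W]\<^bsup>3\<^esup> \<subseteq> edges G")
    case True
    then show ?thesis using ne that by blast
  next
    case False
    then obtain e where "e \<in> [W]\<^bsup>3\<^esup> - edges G" by blast
    moreover from this have "[W]\<^bsup>3\<^esup> - edges G = {e}"
      using few fin by (metis card_le_Suc0_iff_eq One_nat_def finite_Diff is_singletonI' singletonD
          is_singleton_the_elem empty_iff)
    ultimately show ?thesis using that by blast
  qed
  obtain f where f: "bij_betw f W {1..p}"
    using W ex_bij_betw_nat_finite_1[OF W(2)] by (metis bij_betw_inv)
  have image: "bij_betw (\<lambda>e. f ` e) ([W]\<^bsup>3\<^esup>) ([{1..p}]\<^bsup>3\<^esup>)"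
    using f by (rule bij_betw_nsets)
  have "(\<lambda>e. f ` e) ` ([W]\<^bsup>3\<^esup> - {e}) = [{1..p}]\<^bsup>3\<^esup> - {f ` e}"
    using image e(1) by (auto simp: bij_betw_def inj_on_image_set_diff[of _ "[W]\<^bsup>3\<^esup>"])
  then have "isomorphic (HGraph W ([W]\<^bsup>3\<^esup> - {e})) (HGraph {1..p} ([{1..p}]\<^bsup>3\<^esup> - {f ` e}))"
    using f by (auto simp: isomorphic_def)
  moreover have "subgraph (HGraph W ([W]\<^bsup>3\<^esup> - {e})) G"
    using W e by (auto simp: subgraph_def is_3graph_def)
  moreover have "f ` e \<in> [{1..p}]\<^bsup>3\<^esup>" using image e(1) by (auto simp: bij_betw_def)
  ultimately show ?thesis
    unfolding contains_clique_minus_edge_def contains_copy_def by blast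
qed

text \<open>A missing triple either avoids \<open>v\<close> or is a missing pair of the link of \<open>v\<close> together with \<open>v\<close>.\<close>

lemma card_missing_split:
  assumes G: "is_3graph G" and v: "v \<in> verts G"
  shows "card ([verts G - {v}]\<^bsup>3\<^esup> - edges G) + card ([verts G - {v}]\<^bsup>2\<^esup> - link G v)
      \<le> card ([verts G]\<^bsup>3\<^esup> - edges G)"
proof -
  let ?D = "[verts G - {v}]\<^bsup>3\<^esup> - edges G" and ?P = "[verts G - {v}]\<^bsup>2\<^esup> - link G v"
  have fin: "finite ([verts G]\<^bsup>3\<^esup>)" "finite ([verts G - {v}]\<^bsup>3\<^esup>)" "finite ([verts G - {v}]\<^bsup>2\<^esup>)"
    using G by (simp_all add: is_3graph_def finite_imp_finite_nsets)
  have "inj_on (insert v) ?P" by (rule inj_onI) (auto simp: nsets_def insert_ident)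
  then have "card ?D + card ?P = card ?D + card (insert v ` ?P)" by (simp add: card_image)
  also have "\<dots> = card (?D \<union> insert v ` ?P)"
    using fin by (subst card_Un_disjoint) (auto simp: nsets_def)
  also have "\<dots> \<le> card ([verts G]\<^bsup>3\<^esup> - edges G)"
  proof (rule card_mono)
    show "finite ([verts G]\<^bsup>3\<^esup> - edges G)" using fin by simp
    have "insert v f \<in> [verts G]\<^bsup>3\<^esup> - edges G" if f: "f \<in> ?P" for f
    proof -
      have vf: "v \<notin> f" "f \<subseteq> verts G" "finite f" "card f = 2" using f by (auto simp: nsets_def)
      have "insert v f \<notin> edges G"
      proof
        assume "insert v f \<in> edges G"
        moreover have "f = insert v f - {v}" using vf by auto
        ultimately have "f \<in> link G v" unfolding link_def by blast
        then show False using f by simp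
      qed
      then show ?thesis using vf v by (auto simp: nsets_def)
    qed
    then show "?D \<union> insert v ` ?P \<subseteq> [verts G]\<^bsup>3\<^esup> - edges G"
      using nsets_mono[of "verts G - {v}" "verts G" 3] by auto
  qed
  finally show ?thesis .
qed

text \<open>The witness is the uniform weighting of \<open>W\<close>.\<close>

lemma lagrangian_poly_uniform_bound:
  assumes G: "is_3graph G" and W: "W \<subseteq> verts G" "card W = n" "n > 0"
  shows "\<exists>x\<in>weightings (verts G).
    (real (n choose 3) - card ([W]\<^bsup>3\<^esup> - edges G)) / real n^3 \<le> lagrangian_poly G x"
proof -
  define x :: "'a \<Rightarrow> real" where "x i = (if i \<in> W then 1 / n else 0)" for i
  have fV: "finite (verts G)" using G by (simp add: is_3graph_def)
  then have fW: "finite W" using W by (auto intro: finite_subset)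
  have "(\<Sum>i\<in>verts G. x i) = 1"
    unfolding x_def using fV W by (simp add: sum.If_cases Int_absorb1)
  then have x: "x \<in> weightings (verts G)" by (auto simp: weightings_def x_def)
  have "real (card ([W]\<^bsup>3\<^esup> \<inter> edges G)) = real (n choose 3) - card ([W]\<^bsup>3\<^esup> - edges G)"
    using card_Int_Diff[OF finite_imp_finite_nsets[OF fW], of 3 "edges G"] card_nsets[OF fW, of 3] W
    by simp
  then have "(real (n choose 3) - card ([W]\<^bsup>3\<^esup> - edges G)) / real n^3
      = (\<Sum>e\<in>[W]\<^bsup>3\<^esup> \<inter> edges G. 1 / real n^3)"
    by simp
  also have "\<dots> = (\<Sum>e\<in>[W]\<^bsup>3\<^esup> \<inter> edges G. \<Prod>i\<in>e. x i)"
  proof (intro sum.cong refl)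
    fix e assume "e \<in> [W]\<^bsup>3\<^esup> \<inter> edges G"
    then have e: "e \<subseteq> W" "card e = 3" by (auto simp: nsets_def)
    then have "(\<Prod>i\<in>e. x i) = (\<Prod>i\<in>e. 1 / real n)"
      unfolding x_def by (intro prod.cong) auto
    then show "1 / real n^3 = (\<Prod>i\<in>e. x i)" using e by (simp add: power_one_over)
  qed
  also have "\<dots> \<le> lagrangian_poly G x"
    unfolding lagrangian_poly_def using finite_edges[OF G]
    by (intro sum_mono2) (auto intro!: prod_nonneg simp: x_def)
  finally show ?thesis using x by blast
qed

section \<open>Density of 3-graphs with few missing triples\<close>

theorem theorem5p4:
  fixes m t :: nat and G :: "nat hgraph"
  assumes "m > 0" and "t \<ge> 9"
    and "(t - 1 choose 3) + (t - 2 choose 2) - 1 \<le> m" and "m \<le> t choose 3"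
    and "is_3graph G" and "verts G = {1..t}" and "card (edges G) = m"
    and "card ([{1..t - 1}]\<^bsup>3\<^esup> - edges G) = 2"
    and "\<not> contains_clique_minus_edge G (t - 1)"
  shows "dense_3graph G"
proof (rule dense_3graph_if_optimum_pos)
  show G: "is_3graph G" by fact
  fix x v
  assume x: "x \<in> weightings (verts G)"
    and opt: "\<And>y. y \<in> weightings (verts G) \<Longrightarrow> lagrangian_poly G y \<le> lagrangian_poly G x"
    and v: "v \<in> verts G"
  have cardV: "card (verts G) = t" and fV: "finite (verts G)" using assms(6) by auto
  (* by Pascal's rule, the lower bound for m leaves room for at most t - 1 missing triples *)
  have "t choose 3 = (t - 1 choose 3) + (t - 2 choose 2) + (t - 2)"
  proof -
    have "t = Suc (Suc (t - 2))" using assms(2) by simp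
    then obtain u where "t = Suc (Suc u)" ..
    then show ?thesis by (simp add: eval_nat_numeral)
  qed
  moreover have "card ([verts G]\<^bsup>3\<^esup> - edges G) = (t choose 3) - m"
    using G assms(7) finite_edges[OF G] card_nsets[OF fV, of 3] cardV
    by (simp add: card_Diff_subset is_3graph_def)
  ultimately have missing: "card ([verts G]\<^bsup>3\<^esup> - edges G) \<le> t - 1"
    using assms(2,3) by linarith
  have "card (verts G - {v}) = t - 1" using v cardV fV by simp
  then have "card ([verts G - {v}]\<^bsup>3\<^esup> - edges G) \<ge> 2"
    using contains_clique_minus_edge_if_few_missing[of "verts G - {v}" G "t - 1"] fV assms(2,9)
    by fastforce
  then have few: "card ([verts G - {v}]\<^bsup>2\<^esup> - link G v) + 2 \<le> t - 1"
    using card_missing_split[OF G v] missing by linarith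
  have "\<exists>y\<in>weightings (verts G). (real (t - 1 choose 3) - 2) / real (t - 1)^3 \<le> lagrangian_poly G y"
    using lagrangian_poly_uniform_bound[OF G, of "{1..t - 1}" "t - 1"] assms(2,6,8) by auto
  then have "(real (t - 1 choose 3) - 2) / real (t - 1)^3 \<le> lagrangian_poly G x"
    using opt by (meson order_trans)
  then show "x v > 0"
    using assms(2) cardV by (intro optimum_weighting_pos[OF G _ _ x opt _ v few]) auto
qed

end
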